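(* Assume the standing assumptions below, let $X_*$ be the unique symmetric positive semidefinite solution of $\mathscr R(X)=0$, and suppose there exists $\alpha>0$ with $\mathscr F_{X_*}(Z)\succeq\alpha Z$ for all symmetric $Z\succeq0$. Consider the modified Newton iteration: given symmetric $X_0$, for $k\ge0$ let $X_{k+1}$ solve $$\widehat A_k^{\mathsf T}X_{k+1}+X_{k+1}\widehat A_k+\widehat\Pi_k(X_k)+M_k=0,$$ with $R_k=R+\Pi_{22}(X_k)$, $S_k=X_kB+L+\Pi_{12}(X_k)$, $\widehat A_k=A-BR_k^{-1}S_k^{\mathsf T}$, $P_k=\begin{bmatrix}I_n\\-R_k^{-1}S_k^{\mathsf T}\end{bmatrix}$, $\widehat\Pi_k(X)=P_k^{\mathsf T}\Pi(X)P_k$, $M_k=P_k^{\mathsf T}\begin{bmatrix}Q&L\\L^{\mathsf T}&R\end{bmatrix}P_k$. Suppose $0\preceq X_0\preceq X_*$, $\mathscr R(X_0)\succeq0$, and $F_W(Y)-(Y-W)BR^{-1}B^{\mathsf T}(Y-W)\succeq0$ for all symmetric $W,Y$ with $X_0\preceq W\preceq Y\preceq X_*$. If the sequence $\{X_k\}$ exists and $X_k\succeq0$ for all $k$, then (a) $0\preceq X_0\preceq X_1\preceq\cdots\preceq X_k\preceq X_*$ and $\mathscr R(X_k)\succeq0$ for all $k\ge0$; (b) $\lim_{k\to\infty}X_k=X_*$.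
   Context: Data: $A,Q\in\mathbb{R}^{n\times n}$, $B,L\in\mathbb{R}^{n\times m}$, $R\in\mathbb{R}^{m\times m}$, $A_0^i\in\mathbb{R}^{n\times n}$, $B_0^i\in\mathbb{R}^{n\times m}$ ($i=1,\dots,r$); $A_0^0=A$, $B_0^0=B$. For symmetric $X$: $\Pi(X)=\begin{bmatrix}\Pi_{11}(X)&\Pi_{12}(X)\\\Pi_{12}(X)^{\mathsf T}&\Pi_{22}(X)\end{bmatrix}$ with $\Pi_{11}(X)=\sum_{i=1}^r (A_0^i)^{\mathsf T}XA_0^i$, $\Pi_{12}(X)=\sum_i (A_0^i)^{\mathsf T}XB_0^i$, $\Pi_{22}(X)=\sum_i (B_0^i)^{\mathsf T}XB_0^i$; $L_{\mathrm c}=L+\Pi_{12}$, $R_{\mathrm c}=R+\Pi_{22}$, $Q_{\mathrm c}=Q+\Pi_{11}$; $A_{\mathrm c}(X)=A-BR_{\mathrm c}(X)^{-1}L_{\mathrm c}(X)^{\mathsf T}$, $G_{\mathrm c}(X)=BR_{\mathrm c}(X)^{-1}B^{\mathsf T}$, $H_{\mathrm c}(X)=Q_{\mathrm c}(X)-L_{\mathrm c}(X)R_{\mathrm c}(X)^{-1}L_{\mathrm c}(X)^{\mathsf T}$; $\Omega(X)=\begin{bmatrix}-G_{\mathrm c}(X)&-A_{\mathrm c}(X)\\-A_{\mathrm c}(X)^{\mathsf T}&H_{\mathrm c}(X)\end{bmatrix}$; $\mathscr R(X)=\begin{bmatrix}X\\-I\end{bmatrix}^{\mathsf T}\Omega(X)\begin{bmatrix}X\\-I\end{bmatrix}$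 (equivalently $A^{\mathsf T}X+XA+Q+\Pi_{11}(X)-[XB+L+\Pi_{12}(X)][R+\Pi_{22}(X)]^{-1}[XB+L+\Pi_{12}(X)]^{\mathsf T}$). For symmetric $W$: $\mathscr F_W(Z)=\begin{bmatrix}-I_n\\R_{\mathrm c}(W)^{-1}[L_{\mathrm c}(W)+WB]^{\mathsf T}\end{bmatrix}^{\mathsf T}\Pi(Z)\begin{bmatrix}-I_n\\R_{\mathrm c}(W)^{-1}[L_{\mathrm c}(W)+WB]^{\mathsf T}\end{bmatrix}$ and $F_W(Y)=\begin{bmatrix}Y\\-I_n\end{bmatrix}^{\mathsf T}[\Omega(Y)-\Omega(W)]\begin{bmatrix}Y\\-I_n\end{bmatrix}$. Standing assumptions: (1) $R\succ0$, $\begin{bmatrix}Q&L\\L^{\mathsf T}&R\end{bmatrix}\succeq0$; (2) there is $F\in\mathbb{R}^{m\times n}$ with $\dot S=(A+BF)S+S(A+BF)^{\mathsf T}+\sum_{i=1}^r(A_0^i+B_0^iF)S(A_0^i+B_0^iF)^{\mathsf T}$ exponentially stable; (3) with $C^{\mathsf T}C=Q-LR^{-1}L^{\mathsf T}$, $C\in\mathbb{R}^{p\times n}$, and $\widetilde A_0^i=A_0^i-B_0^iR^{-1}L^{\mathsf T}$, there is $K\in\mathbb{R}^{n\times p}$ with $\dot S=(\widetilde A_0^0+KC)S+S(\widetilde A_0^0+KC)^{\mathsf T}+\sum_{i=1}^r\widetilde A_0^iS(\widetilde A_0^i)^{\mathsf T}$ exponentially stable; (4) $\mathcal N(Q-LR^{-1}L^{\mathsf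 T})\subseteq\mathcal N(L^{\mathsf T})\cap\bigcap_i\mathcal N(A_0^i)$; (5) $(A,B)$ stabilizable and $(Q-LR^{-1}L^{\mathsf T},A)$ detectable. Under (1)–(3), $\mathscr R(X)=0$ has a unique positive semidefinite solution $X_*$. *)

theory Defs
  imports "HOL-Analysis.Analysis"
begin

definition symm :: "real^'n^'n \<Rightarrow> bool" where
  "symm M \<longleftrightarrow> transpose M = M"

definition psd :: "real^'n^'n \<Rightarrow> bool" where
  "psd M \<longleftrightarrow> symm M \<and> (\<forall>x. 0 \<le> x \<bullet> (M *v x))"

definition pd :: "real^'n^'n \<Rightarrow> bool" where
  "pd M \<longleftrightarrow> symm M \<and> (\<forall>x. x \<noteq> 0 \<longrightarrow> 0 < x \<bullet> (M *v x))"

definition loewner :: "real^'n^'n \<Rightarrow> real^'n^'n \<Rightarrow> bool" where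
  "loewner X Y \<longleftrightarrow> psd (Y - X)"

definition blk :: "real^'b^'a \<Rightarrow> real^'c^'a \<Rightarrow> real^'b^'d \<Rightarrow> real^'c^'d \<Rightarrow> real^('b + 'c)^('a + 'd)" where
  "blk M11 M12 M21 M22 = (\<chi> i j. case i of
       Inl a \<Rightarrow> (case j of Inl b \<Rightarrow> M11 $ a $ b | Inr c \<Rightarrow> M12 $ a $ c)
     | Inr d \<Rightarrow> (case j of Inl b \<Rightarrow> M21 $ d $ b | Inr c \<Rightarrow> M22 $ d $ c))"

definition vstk :: "real^'b^'a \<Rightarrow> real^'b^'d \<Rightarrow> real^'b^('a + 'd)" where
  "vstk M1 M2 = (\<chi> i j. case i of Inl a \<Rightarrow> M1 $ a $ j | Inr d \<Rightarrow> M2 $ d $ j)"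

definition exp_stable :: "('v::real_normed_vector \<Rightarrow> 'v) \<Rightarrow> bool" where
  "exp_stable T \<longleftrightarrow> (\<exists>c \<beta>. 0 < \<beta> \<and>
     (\<forall>S :: real \<Rightarrow> 'v. (\<forall>t\<ge>0. (S has_vector_derivative T (S t)) (at t within {0..})) \<longrightarrow>
        (\<forall>t\<ge>0. norm (S t) \<le> c * exp (- \<beta> * t) * norm (S 0))))"

definition stabilizable :: "real^'n^'n \<Rightarrow> real^'m^'n \<Rightarrow> bool" where
  "stabilizable A B \<longleftrightarrow> (\<exists>F :: real^'n^'m. exp_stable (\<lambda>x. (A + B ** F) *v x))"

definition detectable :: "real^'n^'p \<Rightarrow> real^'n^'n \<Rightarrow> bool" where
  "detectable C A \<longleftrightarrow> (\<exists>K :: real^'p^'n. exp_stable (\<lambda>x. (A + K ** C) *v x))"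

definition Pi11 :: "nat \<Rightarrow> (nat \<Rightarrow> real^'n^'n) \<Rightarrow> real^'n^'n \<Rightarrow> real^'n^'n" where
  "Pi11 r A0 X = (\<Sum>i\<in>{1..r}. transpose (A0 i) ** X ** A0 i)"

definition Pi12 :: "nat \<Rightarrow> (nat \<Rightarrow> real^'n^'n) \<Rightarrow> (nat \<Rightarrow> real^'m^'n) \<Rightarrow> real^'n^'n \<Rightarrow> real^'m^'n" where
  "Pi12 r A0 B0 X = (\<Sum>i\<in>{1..r}. transpose (A0 i) ** X ** B0 i)"

definition Pi22 :: "nat \<Rightarrow> (nat \<Rightarrow> real^'m^'n) \<Rightarrow> real^'n^'n \<Rightarrow> real^'m^'m" where
  "Pi22 r B0 X = (\<Sum>i\<in>{1..r}. transpose (B0 i) ** X ** B0 i)"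

definition PiM :: "nat \<Rightarrow> (nat \<Rightarrow> real^'n^'n) \<Rightarrow> (nat \<Rightarrow> real^'m^'n) \<Rightarrow> real^'n^'n
    \<Rightarrow> real^('n + 'm)^('n + 'm)" where
  "PiM r A0 B0 X = blk (Pi11 r A0 X) (Pi12 r A0 B0 X) (transpose (Pi12 r A0 B0 X)) (Pi22 r B0 X)"

definition Lc :: "real^'m^'n \<Rightarrow> nat \<Rightarrow> (nat \<Rightarrow> real^'n^'n) \<Rightarrow> (nat \<Rightarrow> real^'m^'n) \<Rightarrow> real^'n^'n \<Rightarrow> real^'m^'n" where
  "Lc L r A0 B0 X = L + Pi12 r A0 B0 X"

definition Rc :: "real^'m^'m \<Rightarrow> nat \<Rightarrow> (nat \<Rightarrow> real^'m^'n) \<Rightarrow> real^'n^'n \<Rightarrow> real^'m^'m" where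
  "Rc R r B0 X = R + Pi22 r B0 X"

definition Qc :: "real^'n^'n \<Rightarrow> nat \<Rightarrow> (nat \<Rightarrow> real^'n^'n) \<Rightarrow> real^'n^'n \<Rightarrow> real^'n^'n" where
  "Qc Q r A0 X = Q + Pi11 r A0 X"

definition Ac :: "real^'n^'n \<Rightarrow> real^'m^'n \<Rightarrow> real^'m^'n \<Rightarrow> real^'m^'m \<Rightarrow> nat \<Rightarrow> (nat \<Rightarrow> real^'n^'n)
    \<Rightarrow> (nat \<Rightarrow> real^'m^'n) \<Rightarrow> real^'n^'n \<Rightarrow> real^'n^'n" where
  "Ac A B L R r A0 B0 X = A - B ** matrix_inv (Rc R r B0 X) ** transpose (Lc L r A0 B0 X)"

definition Gc :: "real^'m^'n \<Rightarrow> real^'m^'m \<Rightarrow> nat \<Rightarrow> (nat \<Rightarrow> real^'m^'n) \<Rightarrow> real^'n^'n \<Rightarrow> real^'n^'n" where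
  "Gc B R r B0 X = B ** matrix_inv (Rc R r B0 X) ** transpose B"

definition Hc :: "real^'n^'n \<Rightarrow> real^'m^'n \<Rightarrow> real^'m^'m \<Rightarrow> nat \<Rightarrow> (nat \<Rightarrow> real^'n^'n)
    \<Rightarrow> (nat \<Rightarrow> real^'m^'n) \<Rightarrow> real^'n^'n \<Rightarrow> real^'n^'n" where
  "Hc Q L R r A0 B0 X = Qc Q r A0 X - Lc L r A0 B0 X ** matrix_inv (Rc R r B0 X) ** transpose (Lc L r A0 B0 X)"

definition Omega :: "real^'n^'n \<Rightarrow> real^'m^'n \<Rightarrow> real^'n^'n \<Rightarrow> real^'m^'n \<Rightarrow> real^'m^'m \<Rightarrow> nat
    \<Rightarrow> (nat \<Rightarrow> real^'n^'n) \<Rightarrow> (nat \<Rightarrow> real^'m^'n) \<Rightarrow> real^'n^'n \<Rightarrow> real^('n + 'n)^('n + 'n)" where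
  "Omega A B Q L R r A0 B0 X =
     blk (- Gc B R r B0 X) (- Ac A B L R r A0 B0 X)
         (- transpose (Ac A B L R r A0 B0 X)) (Hc Q L R r A0 B0 X)"

definition Ric :: "real^'n^'n \<Rightarrow> real^'m^'n \<Rightarrow> real^'n^'n \<Rightarrow> real^'m^'n \<Rightarrow> real^'m^'m \<Rightarrow> nat
    \<Rightarrow> (nat \<Rightarrow> real^'n^'n) \<Rightarrow> (nat \<Rightarrow> real^'m^'n) \<Rightarrow> real^'n^'n \<Rightarrow> real^'n^'n" where
  "Ric A B Q L R r A0 B0 X =
     transpose (vstk X (- mat 1)) ** Omega A B Q L R r A0 B0 X ** vstk X (- mat 1)"

definition FZ :: "real^'m^'n \<Rightarrow> real^'m^'n \<Rightarrow> real^'m^'m \<Rightarrow> nat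
    \<Rightarrow> (nat \<Rightarrow> real^'n^'n) \<Rightarrow> (nat \<Rightarrow> real^'m^'n) \<Rightarrow> real^'n^'n \<Rightarrow> real^'n^'n \<Rightarrow> real^'n^'n" where
  "FZ B L R r A0 B0 W Z =
     (let V = vstk (- mat 1) (matrix_inv (Rc R r B0 W) ** transpose (Lc L r A0 B0 W + W ** B))
      in transpose V ** PiM r A0 B0 Z ** V)"

definition FY :: "real^'n^'n \<Rightarrow> real^'m^'n \<Rightarrow> real^'n^'n \<Rightarrow> real^'m^'n \<Rightarrow> real^'m^'m \<Rightarrow> nat
    \<Rightarrow> (nat \<Rightarrow> real^'n^'n) \<Rightarrow> (nat \<Rightarrow> real^'m^'n) \<Rightarrow> real^'n^'n \<Rightarrow> real^'n^'n \<Rightarrow> real^'n^'n" where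
  "FY A B Q L R r A0 B0 W Y =
     transpose (vstk Y (- mat 1)) **
       (Omega A B Q L R r A0 B0 Y - Omega A B Q L R r A0 B0 W) ** vstk Y (- mat 1)"

definition newton_step :: "real^'n^'n \<Rightarrow> real^'m^'n \<Rightarrow> real^'n^'n \<Rightarrow> real^'m^'n \<Rightarrow> real^'m^'m \<Rightarrow> nat
    \<Rightarrow> (nat \<Rightarrow> real^'n^'n) \<Rightarrow> (nat \<Rightarrow> real^'m^'n) \<Rightarrow> real^'n^'n \<Rightarrow> real^'n^'n \<Rightarrow> bool" where
  "newton_step A B Q L R r A0 B0 Xk Xk1 \<longleftrightarrow>
     (let Rk = R + Pi22 r B0 Xk;
          Sk = Xk ** B + L + Pi12 r A0 B0 Xk;
          hA = A - B ** matrix_inv Rk ** transpose Sk;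
          Pk = vstk (mat 1 :: real^'n^'n) (- (matrix_inv Rk ** transpose Sk));
          hPi = transpose Pk ** PiM r A0 B0 Xk ** Pk;
          Mk = transpose Pk ** blk Q L (transpose L) R ** Pk
      in transpose hA ** Xk1 + Xk1 ** hA + hPi + Mk = 0)"

end

theory Submission
  imports Defs
begin

text \<open>
  Everything is read off from quadratic forms. With \<open>h(X,x,u)\<close> the Hamiltonian of the control
  problem, completing the square gives
  \<open>h(X,x,u) = x \<bullet> Ric(X) x + (u - gain(X) x) \<bullet> R\<^sub>c(X) (u - gain(X) x)\<close>, and the hypothesis on
  \<open>F\<^sub>W(Y)\<close> together with \<open>R\<^sub>c(W)\<^sup>-\<^sup>1 \<le> R\<^sup>-\<^sup>1\<close> says that \<open>Ric(Y)\<close> dominates the linearisation at \<open>W\<close>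
  of the Riccati operator with frozen coefficients \<open>\<Omega>(W)\<close>.

  The crucial point is that the running cost \<open>M\<^sub>k\<close> is positive definite. A vector \<open>x\<close> in its kernel
  satisfies \<open>L\<^sup>T x = 0\<close>, \<open>A\<^sub>0\<^sup>i x = 0\<close> and \<open>gain(X\<^sub>k) x = 0\<close> by the null space condition; comparing
  Hamiltonians at \<open>X\<^sub>k\<close> and \<open>X\<^sub>*\<close> forces \<open>gain(X\<^sub>*) x = 0\<close>, and then the lower bound
  \<open>\<F>\<^bsub>X\<^sub>*\<^esub>(I) \<ge> \<alpha> I\<close> forces \<open>x = 0\<close>. Hence \<open>X\<^sub>k\<^sub>+\<^sub>1\<close> is a strict Lyapunov matrix for the closed
  loop at \<open>X\<^sub>k\<close>, and solutions of the Lyapunov inequality are positive semidefinite; this yields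
  monotonicity and the upper bound. The limit solves the Riccati equation, its own running
  cost is positive definite for the same reason, and the generalised Lyapunov inequality for its
  closed loop shows that it dominates \<open>X\<^sub>*\<close>.
\<close>

subsection \<open>Semidefinite matrices\<close>

lemma inner_transpose_matrix:
  fixes M :: "real^'a^'b"
  shows "x \<bullet> (transpose M *v y) = (M *v x) \<bullet> y"
  by (metis dot_lmul_matrix inner_commute transpose_matrix_vector)

lemma symm_inner_commute:
  assumes "symm M"
  shows "x \<bullet> (M *v y) = y \<bullet> (M *v x)"
  using assms unfolding symm_def by (metis inner_transpose_matrix inner_commute)

lemma transpose_add: "transpose (M + N) = transpose M + transpose (N :: real^'a^'b)"
  by (simp add: transpose_def vec_eq_iff)

lemma transpose_diff: "transpose (M - N) = transpose M - transpose (N :: real^'a^'b)"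
  by (simp add: transpose_def vec_eq_iff)

lemma transpose_minus: "transpose (- M) = - transpose (M :: real^'a^'b)"
  by (simp add: transpose_def vec_eq_iff)

lemma transpose_sum: "transpose (\<Sum>i\<in>I. f i) = (\<Sum>i\<in>I. transpose (f i :: real^'a^'b))"
  by (simp add: transpose_def vec_eq_iff)

lemma matrix_minus_vector_mult: "(- M) *v x = - (M *v (x :: real^'a))"
  using matrix_vector_mult_diff_rdistrib[of 0 M x] by simp

lemma matrix_vector_mult_minus: "M *v (- x) = - (M *v (x :: real^'a))"
  using matrix_vector_mult_diff_distrib[of M 0 x] by simp

lemma matrix_mult_minus: "M ** (- N) = - (M ** (N :: real^'a^'b))" for M :: "real^'b^'c"
  by (simp add: matrix_matrix_mult_def vec_eq_iff sum_negf)

lemma matrix_sum_vector_mult: "(\<Sum>i\<in>I. f i) *v x = (\<Sum>i\<in>I. f i *v (x :: real^'a))"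
  by (induction I rule: infinite_finite_induct) (simp_all add: matrix_vector_mult_add_rdistrib)

lemma symm_diff: "symm M \<Longrightarrow> symm N \<Longrightarrow> symm (M - N)"
  by (simp add: symm_def transpose_diff)

lemma psd_symm: "psd M \<Longrightarrow> symm M"
  by (simp add: psd_def)

lemma psd_nonneg: "psd M \<Longrightarrow> 0 \<le> x \<bullet> (M *v x)"
  by (simp add: psd_def)

lemma pd_imp_psd: "pd M \<Longrightarrow> psd M"
  unfolding pd_def psd_def by (metis inner_zero_left less_eq_real_def)

lemma loewner_refl: "loewner M M"
  by (simp add: loewner_def psd_def symm_def transpose_def vec_eq_iff)

lemma psd_add: "psd M \<Longrightarrow> psd N \<Longrightarrow> psd (M + N)"
  by (simp add: psd_def symm_def transpose_add matrix_vector_mult_add_rdistrib inner_add_right)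

lemma loewner_trans: "loewner M N \<Longrightarrow> loewner N P \<Longrightarrow> loewner M P"
  unfolding loewner_def using psd_add[of "N - M" "P - N"] by simp

lemma loewner_quad_le: "loewner M N \<Longrightarrow> x \<bullet> (M *v x) \<le> x \<bullet> (N *v x)"
  by (simp add: loewner_def psd_def matrix_vector_mult_diff_rdistrib inner_diff_right)

lemma symm_quad_add:
  assumes "symm M"
  shows "(x + y) \<bullet> (M *v (x + y)) = x \<bullet> (M *v x) + 2 * (x \<bullet> (M *v y)) + y \<bullet> (M *v y)"
  using symm_inner_commute[OF assms, of x y]
  by (simp add: matrix_vector_right_distrib inner_add_left inner_add_right)

lemma symm_quad_diff:
  assumes "symm M"
  shows "(x - y) \<bullet> (M *v (x - y)) = x \<bullet> (M *v x) - 2 * (x \<bullet> (M *v y)) + y \<bullet> (M *v y)"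
  using symm_quad_add[OF assms, of x "- y"] by (simp add: matrix_vector_mult_minus)

lemma symm_matrix_eq_zero:
  assumes "symm M" and "\<And>x. x \<bullet> (M *v x) = 0"
  shows "M = 0"
proof -
  have "x \<bullet> (M *v y) = 0" for x y
    using symm_quad_add[OF assms(1), of x y] assms(2) by simp
  then have "M *v y = 0" for y
    using inner_eq_zero_iff by blast
  then show ?thesis
    by (simp add: matrix_eq)
qed

text \<open>Along \<open>x + t y\<close> with \<open>y = M *v x\<close> the form equals
  \<open>t * (2 * a + t * b)\<close>, where \<open>a\<close> is the squared norm of
  \<open>y\<close>. It turns negative for small negative \<open>t\<close> unless
  \<open>a = 0\<close>.\<close>

lemma psd_kernel:
  assumes "psd M" and "x \<bullet> (M *v x) = 0"
  shows "M *v x = 0"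
proof -
  define y where "y = M *v x"
  define a where "a = y \<bullet> y"
  define b where "b = y \<bullet> (M *v y)"
  have sM: "symm M" and b0: "0 \<le> b"
    using assms by (simp_all add: psd_def b_def)
  have "0 \<le> t * (2 * a + t * b)" for t
  proof -
    have "0 \<le> (x + t *\<^sub>R y) \<bullet> (M *v (x + t *\<^sub>R y))"
      using assms(1) by (rule psd_nonneg)
    also have "\<dots> = 2 * (t * (x \<bullet> (M *v y))) + t * (t * b)"
      using assms(2) by (simp add: symm_quad_add[OF sM] matrix_vector_mult_scaleR b_def)
    also have "x \<bullet> (M *v y) = a"
      using symm_inner_commute[OF sM, of x y] by (simp add: a_def y_def)
    finally show ?thesis
      by (simp add: algebra_simps)
  qed
  \<comment> \<open>The \<open>+ 1\<close> keeps the denominator positive when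
    \<open>b = 0\<close>.\<close>
  from this[of "- a / (b + 1)"] have "0 \<le> - a / (b + 1) * (2 * a - a / (b + 1) * b)"
    by simp
  also have "\<dots> = - (a * a * (b + 2) / ((b + 1) * (b + 1)))"
    using b0 by (simp add: field_simps)
  finally have "a * a * (b + 2) \<le> 0"
    using b0 by (simp add: divide_le_0_iff mult_le_0_iff)
  then have "a = 0"
    using b0 by (auto simp: mult_le_0_iff)
  then show ?thesis
    by (simp add: a_def y_def)
qed

lemma pd_invertible:
  assumes "pd M"
  shows "M ** matrix_inv M = mat 1" and "matrix_inv M ** M = mat 1"
proof -
  have "M *v x = 0 \<Longrightarrow> x = 0" for x
    using assms unfolding pd_def by (metis inner_zero_right less_irrefl)
  then have "invertible M"
    by (simp add: invertible_left_inverse matrix_left_invertible_ker)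
  then have "M ** matrix_inv M = mat 1 \<and> matrix_inv M ** M = mat 1"
    unfolding invertible_def matrix_inv_def by (rule someI_ex)
  then show "M ** matrix_inv M = mat 1" and "matrix_inv M ** M = mat 1"
    by blast+
qed

lemma pd_mult_inv_vector:
  assumes "pd M"
  shows "M *v (matrix_inv M *v x) = x" and "matrix_inv M *v (M *v x) = x"
  using pd_invertible[OF assms] by (simp_all add: matrix_vector_mul_assoc)

lemma symm_matrix_inv:
  assumes "pd M"
  shows "symm (matrix_inv M)"
proof -
  have "transpose (matrix_inv M) ** M = mat 1"
    using pd_invertible(1)[OF assms] assms unfolding pd_def symm_def
    by (metis matrix_transpose_mul transpose_mat)
  then show ?thesis
    unfolding symm_def
    by (metis assms matrix_mul_assoc matrix_mul_lid matrix_mul_rid pd_invertible(1))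
qed

lemma psd_matrix_inv:
  assumes "pd M"
  shows "psd (matrix_inv M)"
  unfolding psd_def
proof (intro conjI allI symm_matrix_inv[OF assms])
  fix x
  have "0 \<le> (matrix_inv M *v x) \<bullet> (M *v (matrix_inv M *v x))"
    using pd_imp_psd[OF assms] by (rule psd_nonneg)
  then show "0 \<le> x \<bullet> (matrix_inv M *v x)"
    by (simp add: pd_mult_inv_vector[OF assms] inner_commute)
qed

text \<open>Expand the form of \<open>M\<close> at \<open>b - a\<close>, where
  \<open>M *v a = x\<close> and \<open>N *v b = x\<close>. Bounding
  \<open>b \<bullet> (M *v b)\<close> by \<open>b \<bullet> (N *v b) = b \<bullet> x\<close> leaves
  \<open>b \<bullet> x \<le> a \<bullet> x\<close>.\<close>

lemma loewner_matrix_inv: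
  assumes "pd M" "pd N" "loewner M N"
  shows "loewner (matrix_inv N) (matrix_inv M)"
  unfolding loewner_def psd_def
proof (intro conjI allI)
  show "symm (matrix_inv M - matrix_inv N)"
    using assms by (simp add: symm_diff symm_matrix_inv)
  fix x
  define a where "a = matrix_inv M *v x"
  define b where "b = matrix_inv N *v x"
  have ab: "M *v a = x" "N *v b = x"
    using assms by (simp_all add: a_def b_def pd_mult_inv_vector)
  have sM: "symm M"
    using assms(1) by (simp add: pd_def)
  have "0 \<le> (b - a) \<bullet> (M *v (b - a))"
    using pd_imp_psd[OF assms(1)] by (rule psd_nonneg)
  also have "\<dots> = b \<bullet> (M *v b) - 2 * (b \<bullet> x) + a \<bullet> x"
    using ab by (simp add: symm_quad_diff[OF sM])
  also have "b \<bullet> (M *v b) \<le> b \<bullet> x"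
    using loewner_quad_le[OF assms(3), of b] ab by simp
  finally show "0 \<le> x \<bullet> ((matrix_inv M - matrix_inv N) *v x)"
    by (simp add: matrix_vector_mult_diff_rdistrib inner_diff_right a_def b_def inner_commute)
qed

lemma symm_congruence: "symm M \<Longrightarrow> symm (transpose P ** M ** P)"
  by (simp add: symm_def matrix_transpose_mul matrix_mul_assoc)

lemma symm_congruence': "symm M \<Longrightarrow> symm (P ** M ** transpose P)"
  using symm_congruence[of M "transpose P"] by simp

lemma psd_congruence_quad: "psd M \<Longrightarrow> 0 \<le> x \<bullet> ((transpose P ** M ** P) *v x)"
  by (simp only: matrix_vector_mul_assoc[symmetric] inner_transpose_matrix psd_nonneg)

lemma symm_sum: "(\<And>i. i \<in> I \<Longrightarrow> symm (f i)) \<Longrightarrow> symm (\<Sum>i\<in>I. f i)"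
  by (simp add: symm_def transpose_sum)

lemma symm_add: "symm M \<Longrightarrow> symm N \<Longrightarrow> symm (M + N)"
  by (simp add: symm_def transpose_add)

subsection \<open>Lyapunov inequalities\<close>

text \<open>Boundary argument: if \<open>Z\<close> were not semidefinite, the least \<open>t\<close>
  making \<open>t P + Z\<close> semidefinite would be positive, and that matrix would annihilate
  some \<open>w \<noteq> 0\<close>. There the drift term vanishes and the sum is nonnegative,
  against \<open>neg\<close> and \<open>nonpos\<close>.\<close>

lemma generalized_lyapunov:
  fixes H P Z :: "real^'n^'n" and D :: "'i \<Rightarrow> real^'n^'n"
  assumes P: "psd P" and Z: "symm Z"
    and neg: "\<And>x. x \<noteq> 0 \<Longrightarrow> 2 * ((P *v x) \<bullet> (H *v x)) + (\<Sum>i\<in>I. (D i *v x) \<bullet> (P *v (D i *v x))) < 0"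
    and nonpos: "\<And>x. 2 * ((Z *v x) \<bullet> (H *v x)) + (\<Sum>i\<in>I. (D i *v x) \<bullet> (Z *v (D i *v x))) \<le> 0"
  shows "psd Z"
proof (rule ccontr)
  define \<phi> where "\<phi> Y x = 2 * ((Y *v x) \<bullet> (H *v x)) + (\<Sum>i\<in>I. (D i *v x) \<bullet> (Y *v (D i *v x)))" for Y x
  have kernel_nonneg: "0 \<le> \<phi> Y x" if "psd Y" "Y *v x = 0" for Y x
    using that by (simp add: \<phi>_def sum_nonneg psd_nonneg)
  \<comment> \<open>Definiteness of \<open>P\<close> comes from \<open>neg\<close>: on the kernel of
    \<open>P\<close> the expression would be nonnegative.\<close>
  have P_pos: "0 < x \<bullet> (P *v x)" if "x \<noteq> 0" for x
    using psd_nonneg[OF P, of x] psd_kernel[OF P, of x] kernel_nonneg[OF P, of x] neg[OF that]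
    by (fastforce simp: \<phi>_def)
  assume "\<not> psd Z"
  then obtain v where v: "v \<bullet> (Z *v v) < 0"
    using Z by (auto simp: psd_def not_le)
  then have v0: "v \<noteq> 0" by auto
  \<comment> \<open>The maximum of \<open>q\<close> is the least multiple of \<open>P\<close> that
    lifts \<open>Z\<close> into the semidefinite cone.\<close>
  define q where "q x = - (x \<bullet> (Z *v x)) / (x \<bullet> (P *v x))" for x
  have "continuous_on (sphere 0 1) q"
    unfolding q_def using P_pos
    by (intro continuous_intros) (metis less_irrefl norm_zero mem_sphere_0 zero_neq_one)
  moreover have "v /\<^sub>R norm v \<in> sphere 0 1"
    using v0 by simp
  ultimately obtain w where w: "w \<in> sphere 0 1" and w_max: "\<And>x. x \<in> sphere 0 1 \<Longrightarrow> q x \<le> q w"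
    using continuous_attains_sup[OF compact_sphere, of 0 1 q] by blast
  have q_scale: "q (c *\<^sub>R x) = q x" if "c \<noteq> 0" for c x
    using that by (simp add: q_def matrix_vector_mult_scaleR)
  have q_max: "q x \<le> q w" if "x \<noteq> 0" for x
  proof -
    have "x /\<^sub>R norm x \<in> sphere 0 1"
      using that by simp
    from w_max[OF this] show ?thesis
      using q_scale[of "inverse (norm x)" x] that by simp
  qed
  have "0 < q v"
    using v P_pos[OF v0] by (simp add: q_def divide_neg_pos)
  then have t: "0 < q w"
    using q_max[OF v0] by simp
  define Y where "Y = q w *\<^sub>R P + Z"
  have Y_quad: "x \<bullet> (Y *v x) = q w * (x \<bullet> (P *v x)) + x \<bullet> (Z *v x)" for x
    by (simp add: Y_def matrix_vector_mult_add_rdistrib inner_add_right scaleR_matrix_vector_assoc[symmetric])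
  have "psd Y"
    unfolding psd_def
  proof (intro conjI allI)
    show "symm Y"
      using psd_symm[OF P] Z by (simp add: Y_def symm_def transpose_add transpose_scalar)
    show "0 \<le> x \<bullet> (Y *v x)" for x
    proof (cases "x = 0")
      case False
      from q_max[OF this] P_pos[OF this] show ?thesis
        unfolding Y_quad q_def[of x] by (simp add: field_simps)
    qed simp
  qed
  moreover have w0: "w \<noteq> 0"
    using w by auto
  have "w \<bullet> (Y *v w) = 0"
    using P_pos[OF w0] by (simp add: Y_quad q_def)
  ultimately have "0 \<le> \<phi> Y w"
    by (intro kernel_nonneg psd_kernel)
  also have "\<phi> Y w = q w * \<phi> P w + \<phi> Z w"
    by (simp add: \<phi>_def Y_def matrix_vector_mult_add_rdistrib inner_add_right inner_add_left
        scaleR_matrix_vector_assoc[symmetric] sum.distrib sum_distrib_left algebra_simps)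
  also have "\<dots> < 0"
    using neg[OF w0] nonpos[of w] t by (simp add: \<phi>_def mult_pos_neg add_neg_nonpos)
  finally show False by simp
qed

subsection \<open>Limits of matrices\<close>

lemma inner_axis_matrix: "axis i 1 \<bullet> (M *v axis j 1) = (M :: real^'n^'m) $ i $ j"
  by (simp add: inner_axis' matrix_vector_mult_basis column_def)

text \<open>The quadratic forms converge as bounded monotone real sequences; polarisation at
  coordinate vectors recovers the entries.\<close>

lemma loewner_mono_convergent:
  fixes X :: "nat \<Rightarrow> real^'n^'n"
  assumes symm: "\<And>k. symm (X k)" and mono: "\<And>k. loewner (X k) (X (Suc k))"
    and bound: "\<And>k. loewner (X k) U"
  shows "convergent X"
proof -
  have conv: "convergent (\<lambda>k. x \<bullet> (X k *v x))" for x
  proof (rule Bseq_monoseq_convergent)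
    have inc: "incseq (\<lambda>k. x \<bullet> (X k *v x))"
      using loewner_quad_le[OF mono] by (simp add: incseq_SucI)
    then show "monoseq (\<lambda>k. x \<bullet> (X k *v x))"
      by (rule incseq_imp_monoseq)
    show "Bseq (\<lambda>k. x \<bullet> (X k *v x))"
    proof (rule BseqI')
      show "norm (x \<bullet> (X k *v x)) \<le> max \<bar>x \<bullet> (X 0 *v x)\<bar> \<bar>x \<bullet> (U *v x)\<bar>" for k
        using loewner_quad_le[OF bound, of x k] incseqD[OF inc, of 0 k] by auto
    qed
  qed
  have "convergent (\<lambda>k. X k $ i $ j)" for i j
  proof -
    let ?e = "\<lambda>l. axis l 1 :: real^'n"
    have "X k $ i $ j = ((?e i + ?e j) \<bullet> (X k *v (?e i + ?e j))
        - ?e i \<bullet> (X k *v ?e i) - ?e j \<bullet> (X k *v ?e j)) * inverse 2" for k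
      by (simp add: symm_quad_add[OF symm] inner_axis_matrix)
    moreover have "convergent (\<lambda>k. ((?e i + ?e j) \<bullet> (X k *v (?e i + ?e j))
        - ?e i \<bullet> (X k *v ?e i) - ?e j \<bullet> (X k *v ?e j)) * inverse 2)"
      by (intro convergent_diff convergent_mult conv convergent_const)
    ultimately show ?thesis
      by (simp only:)
  qed
  then have "(\<lambda>k. X k $ i $ j) \<longlonglongrightarrow> lim (\<lambda>k. X k $ i $ j)" for i j
    by (simp add: convergent_LIMSEQ_iff)
  then have "X \<longlonglongrightarrow> (\<chi> i j. lim (\<lambda>k. X k $ i $ j))"
    by (intro vec_tendstoI) simp
  then show ?thesis
    by (rule convergentI)
qed

lemma tendsto_matrix_mult:
  fixes f :: "'a \<Rightarrow> real^'m^'n" and g :: "'a \<Rightarrow> real^'p^'m"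
  assumes "(f \<longlongrightarrow> a) F" "(g \<longlongrightarrow> b) F"
  shows "((\<lambda>k. f k ** g k) \<longlongrightarrow> a ** b) F"
  unfolding matrix_matrix_mult_def using assms
  by (intro vec_tendstoI) (auto intro!: tendsto_intros)

lemma tendsto_matrix_vector_mult:
  fixes f :: "'a \<Rightarrow> real^'m^'n" and g :: "'a \<Rightarrow> real^'m"
  assumes "(f \<longlongrightarrow> a) F" "(g \<longlongrightarrow> b) F"
  shows "((\<lambda>k. f k *v g k) \<longlongrightarrow> a *v b) F"
  unfolding matrix_vector_mult_def using assms
  by (intro vec_tendstoI) (auto intro!: tendsto_intros)

lemma tendsto_transpose:
  fixes f :: "'a \<Rightarrow> real^'m^'n"
  assumes "(f \<longlongrightarrow> a) F"
  shows "((\<lambda>k. transpose (f k)) \<longlongrightarrow> transpose a) F"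
  unfolding transpose_def using assms
  by (intro vec_tendstoI) (auto intro!: tendsto_intros)

lemma psd_limit:
  fixes X :: "nat \<Rightarrow> real^'n^'n"
  assumes "X \<longlonglongrightarrow> M" "\<And>k. psd (X k)"
  shows "psd M"
  unfolding psd_def symm_def
proof (intro conjI allI)
  show "transpose M = M"
    using tendsto_transpose[OF assms(1)] assms
    by (simp add: psd_def symm_def LIMSEQ_unique)
  show "0 \<le> x \<bullet> (M *v x)" for x
  proof (rule LIMSEQ_le_const)
    show "(\<lambda>k. x \<bullet> (X k *v x)) \<longlonglongrightarrow> x \<bullet> (M *v x)"
      by (intro tendsto_inner tendsto_const tendsto_matrix_vector_mult assms(1))
  qed (use assms(2) psd_nonneg in blast)
qed

subsection \<open>Block matrices\<close>

lemma inner_vec_sum: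
  "(x :: real^('a::finite + 'b::finite)) \<bullet> y =
    (\<Sum>i\<in>UNIV. x $ Inl i * y $ Inl i) + (\<Sum>i\<in>UNIV. x $ Inr i * y $ Inr i)"
  by (simp add: inner_vec_def UNIV_Plus_UNIV[symmetric] sum.Plus del: UNIV_Plus_UNIV)

lemma blk_vstk_quad:
  fixes a :: "real^'c^'a" and b :: "real^'c^'b"
  shows "x \<bullet> ((transpose (vstk a b) ** blk M11 M12 M21 M22 ** vstk a b) *v x) =
    (a *v x) \<bullet> (M11 *v (a *v x)) + (a *v x) \<bullet> (M12 *v (b *v x))
    + (b *v x) \<bullet> (M21 *v (a *v x)) + (b *v x) \<bullet> (M22 *v (b *v x))"
proof -
  let ?v = "vstk a b *v x"
  have v: "?v $ Inl i = (a *v x) $ i" "?v $ Inr j = (b *v x) $ j" for i j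
    by (simp_all add: vstk_def matrix_vector_mult_def)
  have "x \<bullet> ((transpose (vstk a b) ** blk M11 M12 M21 M22 ** vstk a b) *v x) =
      ?v \<bullet> (blk M11 M12 M21 M22 *v ?v)"
    by (simp only: matrix_vector_mul_assoc[symmetric] inner_transpose_matrix)
  moreover have "(blk M11 M12 M21 M22 *v ?v) $ Inl i = (M11 *v (a *v x) + M12 *v (b *v x)) $ i"
      "(blk M11 M12 M21 M22 *v ?v) $ Inr j = (M21 *v (a *v x) + M22 *v (b *v x)) $ j" for i j
    by (subst matrix_vector_mult_def,
        simp add: UNIV_Plus_UNIV[symmetric] sum.Plus v blk_def matrix_vector_mult_def[of M11]
          matrix_vector_mult_def[of M12] matrix_vector_mult_def[of M21] matrix_vector_mult_def[of M22]
          del: UNIV_Plus_UNIV)+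
  ultimately show ?thesis
    by (simp add: inner_vec_sum v inner_vec_def inner_add_right sum.distrib algebra_simps)
qed

lemma symm_nth:
  assumes "symm M"
  shows "M $ i $ j = M $ j $ i"
proof -
  have "transpose M $ j $ i = M $ j $ i"
    using assms by (simp add: symm_def)
  then show ?thesis
    by (simp add: transpose_def)
qed

lemma blk_symm_upper:
  assumes "symm (blk M11 M12 (transpose M12) M22)"
  shows "symm M11"
proof -
  have "M11 $ j $ i = M11 $ i $ j" for i j
    using symm_nth[OF assms, of "Inl j" "Inl i"] by (simp add: blk_def)
  then show ?thesis
    by (simp add: symm_def transpose_def vec_eq_iff)
qed

lemma transpose_blk:
  "transpose (blk M11 M12 M21 M22) = blk (transpose M11) (transpose M21) (transpose M12) (transpose M22)"
  by (simp add: transpose_def vec_eq_iff blk_def split: sum.splits)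

lemma symm_blk: "symm M11 \<Longrightarrow> symm M22 \<Longrightarrow> symm (blk M11 M12 (transpose M12) M22)"
  by (simp add: symm_def transpose_blk)

subsection \<open>The Riccati operator\<close>

locale riccati_data =
  fixes A Q :: "real^'n^'n" and B L :: "real^'m^'n" and R :: "real^'m^'m"
    and r :: nat and A0 :: "nat \<Rightarrow> real^'n^'n" and B0 :: "nat \<Rightarrow> real^'m^'n"
  assumes R_pd: "pd R" and QLR_psd: "psd (blk Q L (transpose L) R)"
begin

abbreviation "ric \<equiv> Ric A B Q L R r A0 B0"
abbreviation "rc \<equiv> Rc R r B0"

text \<open>The optimal feedback: the closed loop of the iteration is
  \<open>A + B ** gain X\<close>, and its \<open>Pk\<close> is
  \<open>vstk (mat 1) (gain X)\<close>.\<close>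

definition gain :: "real^'n^'n \<Rightarrow> real^'n^'m" where
  "gain X = - (matrix_inv (rc X) ** transpose (X ** B + L + Pi12 r A0 B0 X))"

definition stage_cost :: "real^'n \<Rightarrow> real^'m \<Rightarrow> real" where
  "stage_cost x u = x \<bullet> (Q *v x) + 2 * (x \<bullet> (L *v u)) + u \<bullet> (R *v u)"

definition noise_cost :: "real^'n^'n \<Rightarrow> real^'n \<Rightarrow> real^'m \<Rightarrow> real" where
  "noise_cost X x u = (\<Sum>i\<in>{1..r}. (A0 i *v x + B0 i *v u) \<bullet> (X *v (A0 i *v x + B0 i *v u)))"

text \<open>For symmetric \<open>X\<close>, the generator of the diffusion with drift
  \<open>A x + B u\<close> and noise directions \<open>A0 i x + B0 i u\<close>, applied to
  \<open>x \<bullet> (X *v x)\<close>, plus the running cost.\<close>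

definition hamiltonian :: "real^'n^'n \<Rightarrow> real^'n \<Rightarrow> real^'m \<Rightarrow> real" where
  "hamiltonian X x u = 2 * ((X *v x) \<bullet> (A *v x + B *v u)) + stage_cost x u + noise_cost X x u"

lemma symm_R: "symm R"
  using R_pd by (simp add: pd_def)

lemma symm_Q: "symm Q"
  by (rule blk_symm_upper[OF psd_symm[OF QLR_psd]])

lemma Pi_quad:
  "x \<bullet> (Pi11 r A0 X *v y) = (\<Sum>i\<in>{1..r}. (A0 i *v x) \<bullet> (X *v (A0 i *v y)))"
  "x \<bullet> (Pi12 r A0 B0 X *v u) = (\<Sum>i\<in>{1..r}. (A0 i *v x) \<bullet> (X *v (B0 i *v u)))"
  "v \<bullet> (Pi22 r B0 X *v u) = (\<Sum>i\<in>{1..r}. (B0 i *v v) \<bullet> (X *v (B0 i *v u)))"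
  unfolding Pi11_def Pi12_def Pi22_def
  by (simp_all only: matrix_sum_vector_mult inner_sum_right matrix_vector_mul_assoc[symmetric]
      inner_transpose_matrix)

lemma noise_cost_expand:
  assumes "symm X"
  shows "noise_cost X x u =
    x \<bullet> (Pi11 r A0 X *v x) + 2 * (x \<bullet> (Pi12 r A0 B0 X *v u)) + u \<bullet> (Pi22 r B0 X *v u)"
  unfolding noise_cost_def Pi_quad
  by (simp add: symm_quad_add[OF assms] sum.distrib sum_distrib_left)

lemma noise_cost_nonneg: "psd X \<Longrightarrow> 0 \<le> noise_cost X x u"
  by (simp add: noise_cost_def sum_nonneg psd_nonneg)

lemma noise_cost_diff: "noise_cost (X - Y) x u = noise_cost X x u - noise_cost Y x u"
  by (simp add: noise_cost_def matrix_vector_mult_diff_rdistrib inner_diff_right sum_subtractf)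

lemma symm_Pi: "symm X \<Longrightarrow> symm (Pi11 r A0 X)" "symm X \<Longrightarrow> symm (Pi22 r B0 X)"
  unfolding Pi11_def Pi22_def by (intro symm_sum symm_congruence; simp)+

lemma pd_rc:
  assumes "psd X"
  shows "pd (rc X)"
  unfolding pd_def
proof (intro conjI allI impI)
  show "symm (rc X)"
    unfolding Rc_def by (intro symm_add symm_R symm_Pi psd_symm assms)
  fix u :: "real^'m" assume "u \<noteq> 0"
  then have "0 < u \<bullet> (R *v u)"
    using R_pd by (simp add: pd_def)
  moreover have "0 \<le> u \<bullet> (Pi22 r B0 X *v u)"
    using assms by (simp add: Pi_quad sum_nonneg psd_nonneg)
  ultimately show "0 < u \<bullet> (rc X *v u)"
    by (simp add: Rc_def matrix_vector_mult_add_rdistrib inner_add_right)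
qed

lemma rc_mono:
  assumes "loewner X Y"
  shows "loewner (rc X) (rc Y)"
proof -
  have *: "rc Y - rc X = Pi22 r B0 (Y - X)"
    by (simp add: Rc_def Pi22_def matrix_eq matrix_sum_vector_mult matrix_vector_mult_diff_rdistrib
        matrix_vector_mul_assoc[symmetric] sum_subtractf matrix_vector_mult_diff_distrib
        del: transpose_matrix_vector)
  show ?thesis
    unfolding loewner_def * psd_def
  proof (intro conjI allI symm_Pi)
    show "symm (Y - X)" using assms by (simp add: loewner_def psd_def)
    show "0 \<le> u \<bullet> (Pi22 r B0 (Y - X) *v u)" for u
      using assms by (simp add: Pi_quad sum_nonneg psd_nonneg loewner_def)
  qed
qed

lemma loewner_R_rc: "psd X \<Longrightarrow> loewner R (rc X)"
  using symm_Pi(2)[of X]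
  by (simp add: loewner_def psd_def Rc_def Pi_quad sum_nonneg)

lemma gain_vector:
  assumes "symm X"
  shows "gain X *v x =
    - (matrix_inv (rc X) *v (transpose B *v (X *v x) + transpose (Lc L r A0 B0 X) *v x))"
proof -
  have "transpose (X ** B) = transpose B ** X"
    using assms by (simp add: matrix_transpose_mul symm_def)
  then show ?thesis
    by (simp add: gain_def Lc_def transpose_add matrix_minus_vector_mult
        matrix_vector_mult_add_rdistrib matrix_vector_mul_assoc[symmetric] add.assoc
        del: transpose_matrix_vector)
qed

section \<open>Quadratic forms of \<open>Omega\<close>, \<open>FY\<close> and the Riccati
  operator\<close>

lemma Omega_quad:
  "x \<bullet> ((transpose (vstk Y (- mat 1)) ** Omega A B Q L R r A0 B0 W ** vstk Y (- mat 1)) *v x) =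
    - ((Y *v x) \<bullet> (Gc B R r B0 W *v (Y *v x))) + 2 * ((Y *v x) \<bullet> (Ac A B L R r A0 B0 W *v x))
    + x \<bullet> (Hc Q L R r A0 B0 W *v x)"
  unfolding Omega_def blk_vstk_quad
  by (simp add: matrix_minus_vector_mult matrix_vector_mult_minus inner_transpose_matrix inner_commute
        del: transpose_matrix_vector)

lemma symm_Gc:
  assumes "psd W"
  shows "symm (Gc B R r B0 W)"
  unfolding Gc_def by (intro symm_congruence' symm_matrix_inv pd_rc assms)

lemma Gc_quad:
  "d \<bullet> (Gc B R r B0 W *v d) = (transpose B *v d) \<bullet> (matrix_inv (rc W) *v (transpose B *v d))"
  unfolding Gc_def
  by (simp only: matrix_vector_mul_assoc[symmetric] inner_transpose_matrix[of d "transpose B", simplified transpose_transpose])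

text \<open>With \<open>Omega\<close> frozen at \<open>W\<close> the form is quadratic in
  \<open>Y\<close>, so its Taylor expansion at \<open>W\<close> is exact; the linear terms collect
  into the closed loop under \<open>gain W\<close>.\<close>

lemma Omega_quad_shift:
  assumes W: "psd W"
  shows "x \<bullet> ((transpose (vstk Y (- mat 1)) ** Omega A B Q L R r A0 B0 W ** vstk Y (- mat 1)) *v x) =
    x \<bullet> (ric W *v x) + 2 * (((Y - W) *v x) \<bullet> (A *v x + B *v (gain W *v x)))
    - ((Y - W) *v x) \<bullet> (Gc B R r B0 W *v ((Y - W) *v x))"
proof -
  define w where "w = W *v x"
  define d where "d = (Y - W) *v x"
  have Y: "Y *v x = w + d"
    by (simp add: w_def d_def matrix_vector_mult_diff_rdistrib)
  have "A *v x + B *v (gain W *v x) = Ac A B L R r A0 B0 W *v x - Gc B R r B0 W *v w"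
    by (simp add: gain_vector[OF psd_symm[OF W]] w_def Ac_def Gc_def matrix_vector_mult_diff_rdistrib
        matrix_vector_mul_assoc[symmetric] matrix_vector_mult_minus matrix_vector_right_distrib
        matrix_vector_mult_diff_distrib
        del: transpose_matrix_vector)
  then show ?thesis
    unfolding Omega_quad Ric_def
    by (simp add: Y matrix_vector_right_distrib inner_add_right w_def[symmetric] d_def[symmetric]
        symm_inner_commute[OF symm_Gc[OF W], of w d] inner_add_left inner_diff_right)
qed

lemma FY_quad:
  assumes W: "psd W"
  shows "x \<bullet> (FY A B Q L R r A0 B0 W Y *v x) =
    x \<bullet> (ric Y *v x) - x \<bullet> (ric W *v x) - 2 * (((Y - W) *v x) \<bullet> (A *v x + B *v (gain W *v x)))
    + ((Y - W) *v x) \<bullet> (Gc B R r B0 W *v ((Y - W) *v x))"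
proof -
  let ?V = "vstk Y (- mat 1)" and ?O = "Omega A B Q L R r A0 B0"
  have "FY A B Q L R r A0 B0 W Y *v x = ric Y *v x - (transpose ?V ** ?O W ** ?V) *v x"
    by (simp add: FY_def Ric_def matrix_vector_mul_assoc[symmetric] matrix_vector_mult_diff_rdistrib
        matrix_vector_mult_diff_distrib del: transpose_matrix_vector)
  then show ?thesis
    by (simp only: inner_diff_right Omega_quad_shift[OF W])
qed

text \<open>The part depending on \<open>u\<close> is
  \<open>u \<bullet> (rc X *v u) + 2 * ((b + l) \<bullet> u)\<close>, minimised at
  \<open>gain X *v x\<close>; the minimum of the whole is the Riccati form.\<close>

lemma hamiltonian_complete_square:
  assumes X: "psd X"
  shows "hamiltonian X x u =
    x \<bullet> (ric X *v x) + (u - gain X *v x) \<bullet> (rc X *v (u - gain X *v x))"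
proof -
  define b where "b = transpose B *v (X *v x)"
  define l where "l = transpose (Lc L r A0 B0 X) *v x"
  define V where "V = matrix_inv (rc X)"
  have g: "gain X *v x = - (V *v (b + l))"
    using gain_vector[OF psd_symm[OF X], of x] by (simp add: b_def l_def V_def)
  have V: "rc X *v (V *v y) = y" for y
    using pd_mult_inv_vector[OF pd_rc[OF X]] by (simp add: V_def)
  have sV: "symm V"
    unfolding V_def by (intro symm_matrix_inv pd_rc X)
  have sR: "symm (rc X)"
    using pd_rc[OF X] by (simp add: pd_def)
  have b: "b \<bullet> y = (X *v x) \<bullet> (B *v y)" for y
    unfolding b_def using inner_transpose_matrix[of y B "X *v x"] by (simp add: inner_commute)
  have l: "l \<bullet> y = x \<bullet> (L *v y) + x \<bullet> (Pi12 r A0 B0 X *v y)" for y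
    unfolding l_def using inner_transpose_matrix[of y "Lc L r A0 B0 X" x]
    by (simp add: inner_commute Lc_def matrix_vector_mult_add_rdistrib inner_add_right)
  have G: "(X *v x) \<bullet> (Gc B R r B0 X *v (X *v x)) = b \<bullet> (V *v b)"
    by (simp add: Gc_quad b_def V_def)
  have Ac: "(X *v x) \<bullet> (Ac A B L R r A0 B0 X *v x) = (X *v x) \<bullet> (A *v x) - b \<bullet> (V *v l)"
    by (simp add: b Ac_def matrix_vector_mult_diff_rdistrib inner_diff_right l_def V_def
        matrix_vector_mul_assoc[symmetric] del: transpose_matrix_vector)
  have H: "x \<bullet> (Hc Q L R r A0 B0 X *v x) =
      x \<bullet> (Q *v x) + x \<bullet> (Pi11 r A0 X *v x) - l \<bullet> (V *v l)"
    unfolding l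
    by (simp add: Hc_def Qc_def Lc_def matrix_vector_mult_diff_rdistrib inner_diff_right l_def V_def
        matrix_vector_mult_add_rdistrib inner_add_right
        matrix_vector_mul_assoc[symmetric] del: transpose_matrix_vector)
  have ric: "x \<bullet> (ric X *v x) = 2 * ((X *v x) \<bullet> (A *v x)) + x \<bullet> (Q *v x) + x \<bullet> (Pi11 r A0 X *v x)
      - (b + l) \<bullet> (V *v (b + l))"
    unfolding Ric_def Omega_quad G Ac H symm_quad_add[OF sV] by simp
  have "(u - gain X *v x) \<bullet> (rc X *v (u - gain X *v x)) =
      u \<bullet> (rc X *v u) + 2 * ((b + l) \<bullet> u) + (b + l) \<bullet> (V *v (b + l))"
    using symm_quad_add[OF sR, of u "V *v (b + l)"] by (simp add: g V inner_commute)
  moreover have "u \<bullet> (rc X *v u) = u \<bullet> (R *v u) + u \<bullet> (Pi22 r B0 X *v u)"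
    by (simp add: Rc_def matrix_vector_mult_add_rdistrib inner_add_right)
  ultimately show ?thesis
    unfolding ric hamiltonian_def stage_cost_def noise_cost_expand[OF psd_symm[OF X]]
    by (simp add: inner_add_left inner_add_right b l algebra_simps)
qed

lemma hamiltonian_gain: "psd X \<Longrightarrow> hamiltonian X x (gain X *v x) = x \<bullet> (ric X *v x)"
  by (simp add: hamiltonian_complete_square)

section \<open>Costs as congruences, and the Newton equation\<close>

lemma stage_cost_congruence:
  "x \<bullet> ((transpose (vstk (mat 1) F) ** blk Q L (transpose L) R ** vstk (mat 1) F) *v x)
    = stage_cost x (F *v x)"
  unfolding blk_vstk_quad stage_cost_def
  by (simp add: inner_transpose_matrix inner_commute del: transpose_matrix_vector)

lemma noise_cost_congruence:
  assumes "symm X"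
  shows "x \<bullet> ((transpose (vstk (mat 1) F) ** PiM r A0 B0 X ** vstk (mat 1) F) *v x)
    = noise_cost X x (F *v x)"
  unfolding PiM_def blk_vstk_quad noise_cost_expand[OF assms]
  by (simp add: inner_transpose_matrix inner_commute del: transpose_matrix_vector)

text \<open>The column in \<open>FZ\<close> is the negative of \<open>vstk (mat 1) (gain W)\<close>,
  and the sign cancels in the congruence.\<close>

lemma FZ_quad:
  assumes "symm Z"
  shows "x \<bullet> (FZ B L R r A0 B0 W Z *v x) = noise_cost Z x (gain W *v x)"
proof -
  have "vstk (- mat 1) (matrix_inv (rc W) ** transpose (Lc L r A0 B0 W + W ** B)) =
      - vstk (mat 1) (gain W)"
    by (auto simp: vstk_def vec_eq_iff gain_def Lc_def add_ac split: sum.splits)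
  then have "FZ B L R r A0 B0 W Z *v x =
      (transpose (vstk (mat 1) (gain W)) ** PiM r A0 B0 Z ** vstk (mat 1) (gain W)) *v x"
    by (simp add: FZ_def Let_def transpose_minus matrix_vector_mul_assoc[symmetric]
        matrix_minus_vector_mult matrix_vector_mult_minus del: transpose_matrix_vector)
  then show ?thesis
    by (simp only: noise_cost_congruence[OF assms])
qed

lemma stage_cost_gain_nonneg: "0 \<le> stage_cost x (F *v x)"
  using psd_congruence_quad[OF QLR_psd, of x "vstk (mat 1) F"] by (simp only: stage_cost_congruence)

text \<open>Only the drift sees the new iterate; the noise is charged at the old one. Symmetry of
  \<open>X'\<close> merges the two adjoint Lyapunov terms.\<close>

lemma newton_step_quad:
  assumes step: "newton_step A B Q L R r A0 B0 X X'" and X: "symm X" and X': "symm X'"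
  shows "2 * ((X' *v x) \<bullet> (A *v x + B *v (gain X *v x)))
    + stage_cost x (gain X *v x) + noise_cost X x (gain X *v x) = 0"
proof -
  let ?P = "vstk (mat 1) (gain X)" and ?H = "A + B ** gain X"
  have "transpose ?H ** X' + X' ** ?H + transpose ?P ** PiM r A0 B0 X ** ?P
      + transpose ?P ** blk Q L (transpose L) R ** ?P = 0"
    using step unfolding newton_step_def Let_def gain_def Rc_def
    by (simp add: matrix_mul_assoc matrix_mult_minus)
  then have "x \<bullet> ((transpose ?H ** X' + X' ** ?H + transpose ?P ** PiM r A0 B0 X ** ?P
      + transpose ?P ** blk Q L (transpose L) R ** ?P) *v x) = 0"
    by simp
  moreover define c where "c = (X' *v x) \<bullet> (A *v x + B *v (gain X *v x))"
  moreover have "x \<bullet> ((transpose ?H ** X') *v x) = c"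
    unfolding c_def
    by (simp only: matrix_vector_mul_assoc[symmetric] inner_transpose_matrix
        matrix_vector_mult_add_rdistrib inner_commute)
  moreover have "x \<bullet> ((X' ** ?H) *v x) = c"
    using symm_inner_commute[OF X', of x "A *v x + B *v (gain X *v x)"] unfolding c_def
    by (simp add: matrix_vector_mul_assoc[symmetric] matrix_vector_mult_add_rdistrib inner_commute)
  ultimately have "c + c + noise_cost X x (gain X *v x) + stage_cost x (gain X *v x) = 0"
    by (simp only: matrix_vector_mult_add_rdistrib inner_add_right stage_cost_congruence
        noise_cost_congruence[OF X])
  then show ?thesis
    unfolding c_def[symmetric] by simp
qed

lemma symm_ric:
  assumes "psd X"
  shows "symm (ric X)"
proof -
  have "symm (Hc Q L R r A0 B0 X)"
    unfolding Hc_def Qc_def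
    by (intro symm_diff symm_add symm_Q symm_Pi symm_congruence' symm_matrix_inv pd_rc psd_symm assms)
  then have "symm (Omega A B Q L R r A0 B0 X)"
    unfolding Omega_def using symm_Gc[OF assms]
    by (simp add: transpose_minus[symmetric]) (intro symm_blk; simp add: symm_def transpose_minus)
  then show ?thesis
    unfolding Ric_def by (rule symm_congruence)
qed

text \<open>By \<open>FY_quad\<close> the gap between the two sides is the form of \<open>FY\<close>
  minus that of \<open>Gc\<close> at \<open>(Y - W) *v x\<close>. Since \<open>R \<le> rc W\<close>,
  inversion makes the \<open>R\<close> term in \<open>FWY\<close> at least the \<open>Gc\<close>
  term.\<close>

lemma ric_increment:
  assumes W: "psd W"
    and FWY: "psd (FY A B Q L R r A0 B0 W Y - (Y - W) ** B ** matrix_inv R ** transpose B ** (Y - W))"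
    and sYW: "symm (Y - W)"
  shows "x \<bullet> (ric W *v x) + 2 * (((Y - W) *v x) \<bullet> (A *v x + B *v (gain W *v x))) \<le> x \<bullet> (ric Y *v x)"
proof -
  let ?d = "(Y - W) *v x"
  have "?d \<bullet> (Gc B R r B0 W *v ?d) \<le> (transpose B *v ?d) \<bullet> (matrix_inv R *v (transpose B *v ?d))"
    unfolding Gc_quad
    by (intro loewner_quad_le loewner_matrix_inv R_pd pd_rc loewner_R_rc W)
  also have "\<dots> = x \<bullet> (((Y - W) ** B ** matrix_inv R ** transpose B ** (Y - W)) *v x)"
    using symm_inner_commute[OF sYW, of x "B *v (matrix_inv R *v (transpose B *v ?d))"]
      inner_transpose_matrix[of ?d "transpose B" "matrix_inv R *v (transpose B *v ?d)"]
    by (simp add: matrix_vector_mul_assoc[symmetric] inner_commute del: transpose_matrix_vector)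
  also have "\<dots> \<le> x \<bullet> (FY A B Q L R r A0 B0 W Y *v x)"
    using psd_nonneg[OF FWY, of x]
    by (simp add: matrix_vector_mult_diff_rdistrib[of "FY A B Q L R r A0 B0 W Y"] inner_diff_right)
  finally show ?thesis
    unfolding FY_quad[OF W] by simp
qed

section \<open>Positivity of the running cost\<close>

lemma stage_cost_complete_square:
  "stage_cost x u = x \<bullet> ((Q - L ** matrix_inv R ** transpose L) *v x)
    + (u + matrix_inv R *v (transpose L *v x)) \<bullet> (R *v (u + matrix_inv R *v (transpose L *v x)))"
proof -
  define l where "l = transpose L *v x"
  have l: "l \<bullet> y = x \<bullet> (L *v y)" for y
    unfolding l_def using inner_transpose_matrix[of y L x] by (simp add: inner_commute)
  have "x \<bullet> ((L ** matrix_inv R ** transpose L) *v x) = l \<bullet> (matrix_inv R *v l)"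
    unfolding l by (simp add: l_def matrix_vector_mul_assoc[symmetric] del: transpose_matrix_vector)
  moreover have "(u + matrix_inv R *v l) \<bullet> (R *v (u + matrix_inv R *v l)) =
      u \<bullet> (R *v u) + 2 * (x \<bullet> (L *v u)) + l \<bullet> (matrix_inv R *v l)"
    by (simp add: symm_quad_add[OF symm_R] pd_mult_inv_vector[OF R_pd] l[symmetric] inner_commute)
  ultimately show ?thesis
    by (simp add: stage_cost_def l_def[symmetric] matrix_vector_mult_diff_rdistrib inner_diff_right
        del: transpose_matrix_vector)
qed

text \<open>The feedback \<open>- (matrix_inv R ** transpose L)\<close> annihilates the completed
  square and leaves a stage cost, which is nonnegative.\<close>

lemma psd_schur: "psd (Q - L ** matrix_inv R ** transpose L)"
  unfolding psd_def
proof (intro conjI allI)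
  show "symm (Q - L ** matrix_inv R ** transpose L)"
    by (intro symm_diff symm_Q symm_congruence' symm_matrix_inv R_pd)
  show "0 \<le> x \<bullet> ((Q - L ** matrix_inv R ** transpose L) *v x)" for x
    using stage_cost_gain_nonneg[of x "- (matrix_inv R ** transpose L)"]
    by (simp add: stage_cost_complete_square matrix_minus_vector_mult
        matrix_vector_mul_assoc[symmetric] del: transpose_matrix_vector)
qed

text \<open>\<open>decr\<close> is the sole relation between \<open>W\<close> and \<open>Xs\<close>,
  so the lemma serves both the iterates and their limit. A zero cost makes both terms of the
  completed square vanish.\<close>

lemma stage_cost_gain_pos:
  assumes nullsp: "\<And>x. (Q - L ** matrix_inv R ** transpose L) *v x = 0 \<Longrightarrow>
                   transpose L *v x = 0 \<and> (\<forall>i\<in>{1..r}. A0 i *v x = 0)"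
    and Xs: "psd Xs" "ric Xs = 0"
    and \<alpha>: "0 < \<alpha>" "loewner (\<alpha> *\<^sub>R mat 1) (FZ B L R r A0 B0 Xs (mat 1))"
    and W: "psd W"
    and decr: "x \<bullet> (ric W *v x) + 2 * (((Xs - W) *v x) \<bullet> (A *v x + B *v (gain W *v x))) \<le> 0"
    and x: "x \<noteq> 0"
  shows "0 < stage_cost x (gain W *v x)"
proof (rule ccontr)
  let ?S = "Q - L ** matrix_inv R ** transpose L"
  let ?z = "gain W *v x + matrix_inv R *v (transpose L *v x)"
  assume "\<not> ?thesis"
  then have "x \<bullet> (?S *v x) + ?z \<bullet> (R *v ?z) \<le> 0"
    unfolding stage_cost_complete_square by simp
  then have Sx: "x \<bullet> (?S *v x) = 0" and z: "?z \<bullet> (R *v ?z) = 0"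
    using psd_nonneg[OF psd_schur, of x] psd_nonneg[OF pd_imp_psd[OF R_pd], of ?z] by linarith+
  from Sx have "?S *v x = 0"
    by (rule psd_kernel[OF psd_schur])
  from nullsp[OF this] have Lx: "transpose L *v x = 0" and A0x: "\<And>i. i \<in> {1..r} \<Longrightarrow> A0 i *v x = 0"
    by blast+
  from z have "?z = 0"
    using R_pd unfolding pd_def by (metis less_irrefl)
  with Lx have Wx: "gain W *v x = 0"
    by simp
  have noise: "noise_cost Y x 0 = 0" for Y
    by (simp add: noise_cost_def A0x)
  \<comment> \<open>The Hamiltonians of \<open>Xs\<close> and \<open>W\<close> at the input \<open>0\<close> differ only in the drift term, which
     \<open>decr\<close> controls; this forces the optimal input for \<open>Xs\<close> to vanish as well.\<close>
  let ?g = "gain Xs *v x"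
  have "?g \<bullet> (rc Xs *v ?g) = hamiltonian Xs x 0"
    by (simp add: hamiltonian_complete_square[OF Xs(1)] Xs(2) matrix_vector_mult_minus)
  also have "\<dots> = hamiltonian W x 0 + 2 * (((Xs - W) *v x) \<bullet> (A *v x))"
    by (simp add: hamiltonian_def noise matrix_vector_mult_diff_rdistrib inner_diff_left)
  also have "hamiltonian W x 0 = x \<bullet> (ric W *v x)"
    using hamiltonian_gain[OF W, of x] Wx by simp
  also have "\<dots> + 2 * (((Xs - W) *v x) \<bullet> (A *v x)) \<le> 0"
    using decr Wx by simp
  finally have "?g = 0"
    using pd_rc[OF Xs(1)] unfolding pd_def by (meson not_le)
  moreover have "symm (mat 1 :: real^'n^'n)"
    by (simp add: symm_def)
  \<comment> \<open>At \<open>Z = mat 1\<close> the noise cost is the sum of the squared norms of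
    \<open>A0 i *v x + B0 i *v u\<close>; it vanishes for the zero input because each
    \<open>A0 i *v x\<close> does.\<close>
  ultimately have "x \<bullet> (FZ B L R r A0 B0 Xs (mat 1) *v x) = 0"
    by (simp add: FZ_quad noise)
  then have "\<alpha> * (x \<bullet> x) \<le> 0"
    using loewner_quad_le[OF \<alpha>(2), of x] by (simp add: scaleR_matrix_vector_assoc[symmetric])
  then show False
    using mult_pos_pos[OF \<alpha>(1), of "x \<bullet> x"] x by simp
qed

lemma gain_tendsto:
  assumes psd: "\<And>k. psd (X k)" and mono: "\<And>k. loewner (X k) (X (Suc k))"
    and lim: "X \<longlonglongrightarrow> Xl" and Xl: "psd Xl"
  shows "(\<lambda>k. gain (X k)) \<longlonglongrightarrow> gain Xl"
proof -
  have rc_lim: "(\<lambda>k. rc (X k)) \<longlonglongrightarrow> rc Xl"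
    unfolding Rc_def Pi22_def
    by (intro tendsto_add tendsto_sum tendsto_matrix_mult tendsto_const lim)
  let ?V = "\<lambda>k. matrix_inv (rc (X k))"
  \<comment> \<open>The inverses decrease in the Loewner order, hence converge without any appeal to
     continuity of the matrix inverse.\<close>
  have "convergent (\<lambda>k. - ?V k)"
  proof (rule loewner_mono_convergent)
    show "symm (- ?V k)" for k
      using symm_matrix_inv[OF pd_rc[OF psd]] by (simp add: symm_def transpose_minus)
    show "loewner (- ?V k) (- ?V (Suc k))" for k
      using loewner_matrix_inv[OF pd_rc[OF psd] pd_rc[OF psd] rc_mono[OF mono]]
      by (simp add: loewner_def)
    show "loewner (- ?V k) 0" for k
      using psd_matrix_inv[OF pd_rc[OF psd]] by (simp add: loewner_def)
  qed
  then obtain V where "(\<lambda>k. - ?V k) \<longlonglongrightarrow> V"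
    by (auto simp: convergent_def)
  then have V: "?V \<longlonglongrightarrow> - V"
    using tendsto_minus by fastforce
  \<comment> \<open>Passing to the limit in \<open>?V k ** rc (X k) = mat 1\<close> identifies the
    limit; \<open>V\<close> is the limit of the negated inverses, hence the sign.\<close>
  have "(\<lambda>k. ?V k ** rc (X k)) \<longlonglongrightarrow> - V ** rc Xl"
    by (intro tendsto_matrix_mult V rc_lim)
  then have "- V ** rc Xl = mat 1"
    by (simp add: pd_invertible[OF pd_rc[OF psd]] LIMSEQ_const_iff)
  then have "- V = matrix_inv (rc Xl)"
    by (metis matrix_mul_assoc matrix_mul_lid matrix_mul_rid pd_invertible(1)[OF pd_rc[OF Xl]])
  with V have "?V \<longlonglongrightarrow> matrix_inv (rc Xl)"
    by simp
  then show ?thesis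
    unfolding gain_def Pi12_def
    by (intro tendsto_minus tendsto_matrix_mult tendsto_transpose tendsto_add tendsto_sum
        tendsto_const lim)
qed

end

subsection \<open>The modified Newton iteration\<close>

theorem theoremC5:
  fixes A Q :: "real^'n^'n" and B L :: "real^'m^'n" and R :: "real^'m^'m"
    and r :: nat and A0 :: "nat \<Rightarrow> real^'n^'n" and B0 :: "nat \<Rightarrow> real^'m^'n"
    and Xs :: "real^'n^'n" and X :: "nat \<Rightarrow> real^'n^'n"
  assumes
    \<comment> \<open>(1)\<close>
    R_pd: "pd R"
    and QLR_psd: "psd (blk Q L (transpose L) R)"
    \<comment> \<open>(2)\<close>
    and mss: "\<exists>F :: real^'n^'m. exp_stable (\<lambda>S :: real^'n^'n.
               (A + B ** F) ** S + S ** transpose (A + B ** F)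
               + (\<Sum>i\<in>{1..r}. (A0 i + B0 i ** F) ** S ** transpose (A0 i + B0 i ** F)))"
    \<comment> \<open>(3)\<close>
    and msd: "\<exists>C :: real^'n^'p. transpose C ** C = Q - L ** matrix_inv R ** transpose L \<and>
               (\<exists>K :: real^'p^'n. exp_stable (\<lambda>S :: real^'n^'n.
                  ((A - B ** matrix_inv R ** transpose L) + K ** C) ** S
                  + S ** transpose ((A - B ** matrix_inv R ** transpose L) + K ** C)
                  + (\<Sum>i\<in>{1..r}. (A0 i - B0 i ** matrix_inv R ** transpose L) ** S
                                   ** transpose (A0 i - B0 i ** matrix_inv R ** transpose L))))"
    \<comment> \<open>(4)\<close>
    and nullsp: "\<forall>x. (Q - L ** matrix_inv R ** transpose L) *v x = 0 \<longrightarrow>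
                   transpose L *v x = 0 \<and> (\<forall>i\<in>{1..r}. A0 i *v x = 0)"
    \<comment> \<open>(5)\<close>
    and stab: "stabilizable A B"
    and det: "detectable (Q - L ** matrix_inv R ** transpose L) A"
    \<comment> \<open>X_* is the (unique) symmetric psd solution of the Riccati equation\<close>
    and Xs_psd: "psd Xs"
    and Xs_ric: "Ric A B Q L R r A0 B0 Xs = 0"
    and alpha: "\<exists>\<alpha>>0. \<forall>Z. psd Z \<longrightarrow> loewner (\<alpha> *\<^sub>R Z) (FZ B L R r A0 B0 Xs Z)"
    \<comment> \<open>the iteration\<close>
    and X0_symm: "symm (X 0)"
    and iter: "\<forall>k. newton_step A B Q L R r A0 B0 (X k) (X (Suc k))"
    and X_psd: "\<forall>k. psd (X k)"
    and X0_le: "loewner (X 0) Xs"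
    and X0_ric: "psd (Ric A B Q L R r A0 B0 (X 0))"
    and FWY: "\<forall>W Y. symm W \<longrightarrow> symm Y \<longrightarrow> loewner (X 0) W \<longrightarrow> loewner W Y \<longrightarrow> loewner Y Xs \<longrightarrow>
               psd (FY A B Q L R r A0 B0 W Y
                    - (Y - W) ** B ** matrix_inv R ** transpose B ** (Y - W))"
  shows "(\<forall>k. loewner (X k) (X (Suc k)) \<and> loewner (X k) Xs \<and> psd (X k)
              \<and> psd (Ric A B Q L R r A0 B0 (X k)))
         \<and> X \<longlonglongrightarrow> Xs"
proof -
  interpret riccati_data A Q B L R r A0 B0
    using R_pd QLR_psd by unfold_locales
  obtain \<alpha> where \<alpha>: "0 < \<alpha>" "\<And>Z. psd Z \<Longrightarrow> loewner (\<alpha> *\<^sub>R Z) (FZ B L R r A0 B0 Xs Z)"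
    using alpha by blast
  have "psd (mat 1 :: real^'n^'n)"
    by (simp add: psd_def symm_def)
  note \<alpha>_id = \<alpha>(2)[OF this]

  \<comment> \<open>Comparison inequalities and the induction step\<close>
  have diff_symm: "symm (X k - X l)" "symm (Xs - X k)" for k l
    using X_psd Xs_psd by (simp_all add: symm_diff psd_symm)
  \<comment> \<open>This is \<open>ric_increment\<close> at \<open>Y = Xs\<close>, where the Riccati
    operator vanishes.\<close>
  have decr: "x \<bullet> (ric W *v x) + 2 * (((Xs - W) *v x) \<bullet> (A *v x + B *v (gain W *v x))) \<le> 0"
    if W: "psd W" "loewner (X 0) W" "loewner W Xs" for W x
  proof -
    have "psd (FY A B Q L R r A0 B0 W Xs - (Xs - W) ** B ** matrix_inv R ** transpose B ** (Xs - W))"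
      using FWY[rule_format, OF psd_symm[OF W(1)] psd_symm[OF Xs_psd] W(2,3) loewner_refl] .
    from ric_increment[OF W(1) this, of x] show ?thesis
      using Xs_ric W(1) Xs_psd by (simp add: symm_diff psd_symm)
  qed
  have pos: "0 < stage_cost x (gain W *v x)"
    if W: "psd W" "loewner (X 0) W" "loewner W Xs" and "x \<noteq> 0" for W x
    using nullsp that(4)
    by (intro stage_cost_gain_pos[OF _ Xs_psd Xs_ric \<alpha>(1) \<alpha>_id W(1) decr[OF W]]) auto
  have newton: "2 * ((X (Suc k) *v x) \<bullet> (A *v x + B *v (gain (X k) *v x))) =
      - stage_cost x (gain (X k) *v x) - noise_cost (X k) x (gain (X k) *v x)" for k x
    using newton_step_quad[of "X k" "X (Suc k)" x] iter X_psd by (simp add: psd_symm)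
  \<comment> \<open>Subtracting the Hamiltonian of \<open>X k\<close> at its own optimal input
    cancels the stage and noise costs, both taken at \<open>X k\<close>.\<close>
  have incr: "2 * (((X (Suc k) - X k) *v x) \<bullet> (A *v x + B *v (gain (X k) *v x))) = - (x \<bullet> (ric (X k) *v x))"
    for k x
    using newton[where k=k and x=x] hamiltonian_gain[of "X k" x] X_psd
    by (simp add: hamiltonian_def matrix_vector_mult_diff_rdistrib[of "X (Suc k)"] inner_diff_left)
  have step: "loewner (X k) (X (Suc k)) \<and> loewner (X (Suc k)) Xs \<and> psd (ric (X (Suc k)))"
    if k: "loewner (X 0) (X k)" "loewner (X k) Xs" "psd (ric (X k))" for k
  proof (intro conjI)
    let ?H = "A + B ** gain (X k)"
    have H: "?H *v x = A *v x + B *v (gain (X k) *v x)" for x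
      by (simp add: matrix_vector_mult_add_rdistrib matrix_vector_mul_assoc)
    have Xk: "psd (X k)"
      using X_psd by blast
    \<comment> \<open>\<open>X (Suc k)\<close> is a Lyapunov matrix for the closed loop, strict
      since the stage cost is positive. With \<open>I = {}\<close> the criterion is the ordinary
      Lyapunov one, and \<open>D = A0\<close> is a placeholder.\<close>
    have lyapunov: "psd Z" if "symm Z" "\<And>x. 2 * ((Z *v x) \<bullet> (?H *v x)) \<le> 0" for Z
    proof (rule generalized_lyapunov[where P = "X (Suc k)" and H = ?H and I = "{}" and D = A0])
      show "2 * ((X (Suc k) *v x) \<bullet> (?H *v x))
          + (\<Sum>i\<in>{}. (A0 i *v x) \<bullet> (X (Suc k) *v (A0 i *v x))) < 0" if "x \<noteq> 0" for x
        using newton[where k=k and x=x] pos[OF Xk k(1,2) that] noise_cost_nonneg[OF Xk, of x "gain (X k) *v x"]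
        by (simp add: H)
    qed (use that X_psd in simp_all)
    show le: "loewner (X k) (X (Suc k))"
      unfolding loewner_def
      using incr[where k=k] psd_nonneg[OF k(3)] diff_symm by (intro lyapunov) (simp_all add: H)
    show le': "loewner (X (Suc k)) Xs"
      unfolding loewner_def
    proof (intro lyapunov diff_symm)
      fix x
      \<comment> \<open>By \<open>incr\<close> the \<open>ric (X k)\<close> term of
        \<open>decr\<close> is minus the drift term of \<open>X (Suc k) - X k\<close>.\<close>
      have "(Xs - X (Suc k)) *v x = (Xs - X k) *v x - (X (Suc k) - X k) *v x"
        by (simp add: matrix_vector_mult_diff_rdistrib)
      then show "2 * (((Xs - X (Suc k)) *v x) \<bullet> (?H *v x)) \<le> 0"
        using incr[where k=k and x=x] decr[OF Xk k(1,2), of x] by (simp add: H inner_diff_left)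
    qed
    \<comment> \<open>The two bounds just shown admit the pair \<open>X k\<close>,
      \<open>X (Suc k)\<close> in \<open>FWY\<close>; by \<open>incr\<close> the resulting lower
      bound for \<open>ric (X (Suc k))\<close> is zero.\<close>
    have "psd (FY A B Q L R r A0 B0 (X k) (X (Suc k))
        - (X (Suc k) - X k) ** B ** matrix_inv R ** transpose B ** (X (Suc k) - X k))"
      using FWY[rule_format, OF psd_symm psd_symm k(1) le le'] X_psd by blast
    from ric_increment[OF Xk this diff_symm(1)] show "psd (ric (X (Suc k)))"
      using incr[where k=k] symm_ric[of "X (Suc k)"] X_psd by (simp add: psd_def)
  qed
  have bounds: "loewner (X 0) (X k) \<and> loewner (X k) Xs \<and> psd (ric (X k))" for k
  proof (induction k)
    case 0
    show ?case
      using X0_le X0_ric by (simp add: loewner_refl)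
  next
    case (Suc k)
    then show ?case
      using step[of k] loewner_trans by blast
  qed
  have mono: "loewner (X k) (X (Suc k))" for k
    using step bounds by blast

  \<comment> \<open>Convergence and identification of the limit\<close>
  have "convergent X"
    using bounds mono X_psd by (intro loewner_mono_convergent[where U = Xs]) (simp_all add: psd_symm)
  then obtain Xl where lim: "X \<longlonglongrightarrow> Xl"
    by (auto simp: convergent_def)
  have Xl: "psd Xl"
    using psd_limit[OF lim] X_psd by blast
  have Xl_le: "loewner Xl Xs"
    unfolding loewner_def
  proof (rule psd_limit)
    show "(\<lambda>k. Xs - X k) \<longlonglongrightarrow> Xs - Xl"
      by (intro tendsto_diff tendsto_const lim)
    show "psd (Xs - X k)" for k
      using bounds by (simp add: loewner_def)
  qed
  have X0_Xl: "loewner (X 0) Xl"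
    unfolding loewner_def
  proof (rule psd_limit)
    show "(\<lambda>k. X k - X 0) \<longlonglongrightarrow> Xl - X 0"
      by (intro tendsto_diff tendsto_const lim)
    show "psd (X k - X 0)" for k
      using bounds by (simp add: loewner_def)
  qed
  have gain_lim: "(\<lambda>k. gain (X k)) \<longlonglongrightarrow> gain Xl"
    using X_psd mono lim Xl by (intro gain_tendsto) simp_all
  have ric_Xl: "x \<bullet> (ric Xl *v x) = 0" for x
  proof -
    \<comment> \<open>The sequence is constantly zero by \<open>newton\<close>. Both
      \<open>X k\<close> and \<open>X (Suc k)\<close> tend to \<open>Xl\<close>, so the limit is the
      Hamiltonian at the optimal input, which is the Riccati form.\<close>
    have "(\<lambda>k. 2 * ((X (Suc k) *v x) \<bullet> (A *v x + B *v (gain (X k) *v x)))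
        + stage_cost x (gain (X k) *v x) + noise_cost (X k) x (gain (X k) *v x))
      \<longlonglongrightarrow> hamiltonian Xl x (gain Xl *v x)"
      unfolding hamiltonian_def stage_cost_def noise_cost_def
      by (intro tendsto_add tendsto_mult tendsto_inner tendsto_sum tendsto_const
          tendsto_matrix_vector_mult gain_lim lim LIMSEQ_Suc[OF lim])
    then show ?thesis
      by (simp add: newton hamiltonian_gain[OF Xl] LIMSEQ_const_iff)
  qed
  \<comment> \<open>Both \<open>Xl\<close> and \<open>Xs\<close> solve the Riccati equation; the closed loop of \<open>Xl\<close> is stable in
     mean square, which rules out a strictly larger solution.\<close>
  have "psd (Xl - Xs)"
  proof (rule generalized_lyapunov[where P = Xl and H = "A + B ** gain Xl" and I = "{1..r}"
        and D = "\<lambda>i. A0 i + B0 i ** gain Xl"])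
    have expand: "2 * ((Z *v x) \<bullet> ((A + B ** gain Xl) *v x))
        + (\<Sum>i\<in>{1..r}. ((A0 i + B0 i ** gain Xl) *v x) \<bullet> (Z *v ((A0 i + B0 i ** gain Xl) *v x)))
      = hamiltonian Z x (gain Xl *v x) - stage_cost x (gain Xl *v x)" for Z x
      by (simp add: hamiltonian_def noise_cost_def matrix_vector_mult_add_rdistrib matrix_vector_mul_assoc)
    show "2 * ((Xl *v x) \<bullet> ((A + B ** gain Xl) *v x))
        + (\<Sum>i\<in>{1..r}. ((A0 i + B0 i ** gain Xl) *v x) \<bullet> (Xl *v ((A0 i + B0 i ** gain Xl) *v x))) < 0"
      if "x \<noteq> 0" for x
      unfolding expand using pos[OF Xl X0_Xl Xl_le that] by (simp add: hamiltonian_gain[OF Xl] ric_Xl)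
    show "2 * (((Xl - Xs) *v x) \<bullet> ((A + B ** gain Xl) *v x)) + (\<Sum>i\<in>{1..r}.
        ((A0 i + B0 i ** gain Xl) *v x) \<bullet> ((Xl - Xs) *v ((A0 i + B0 i ** gain Xl) *v x))) \<le> 0" for x
    proof -
      \<comment> \<open>The Hamiltonian is affine in its matrix with the stage cost as constant
        term, which cancels in the difference.\<close>
      have "hamiltonian (Xl - Xs) x (gain Xl *v x) - stage_cost x (gain Xl *v x)
          = hamiltonian Xl x (gain Xl *v x) - hamiltonian Xs x (gain Xl *v x)"
        by (simp add: hamiltonian_def noise_cost_diff matrix_vector_mult_diff_rdistrib[of Xl] inner_diff_left)
      \<comment> \<open>The feedback of \<open>Xl\<close> need not be optimal for \<open>Xs\<close>:
        as \<open>ric Xs = 0\<close>, exactly the completed square remains.\<close>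
      moreover have "0 \<le> hamiltonian Xs x (gain Xl *v x)"
        using psd_nonneg[OF pd_imp_psd[OF pd_rc[OF Xs_psd]]]
        by (simp add: hamiltonian_complete_square[OF Xs_psd] Xs_ric)
      ultimately show ?thesis
        unfolding expand by (simp add: hamiltonian_gain[OF Xl] ric_Xl)
    qed
  qed (use Xl Xs_psd in \<open>simp_all add: symm_diff psd_symm\<close>)
  then have "x \<bullet> ((Xs - Xl) *v x) = 0" for x
    using psd_nonneg[of "Xl - Xs" x] psd_nonneg[of "Xs - Xl" x] Xl_le
    by (simp add: loewner_def matrix_vector_mult_diff_rdistrib inner_diff_right)
  then have "Xs - Xl = 0"
    using Xl Xs_psd by (intro symm_matrix_eq_zero) (simp_all add: symm_diff psd_symm)
  then have "X \<longlonglongrightarrow> Xs"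
    using lim by simp
  then show ?thesis
    using mono bounds X_psd by blast
qed

end
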